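(* Let $\phi_n$ denote the $n$-th order $B$-spline on the Heisenberg group $\mathbb{H}$. Then $\operatorname{supp}\phi_1=[0,2]\times[0,1]\times[0,1]$, and for every integer $n\geq 2$, $$\operatorname{supp}\phi_n\subset[0,2n]\times[0,n]\times\big[-\tfrac{1}{2}(n+2)(n-1),\ \tfrac{1}{2}(n+1)(n+2)-2\big].$$
   Context: The Heisenberg group $\mathbb{H}$ is $\mathbb{R}^3$ with the group law $(x,y,t)(x',y',t')=(x+x',\,y+y',\,t+t'+\tfrac12(x'y-y'x))$, so that $(x,y,t)^{-1}=(-x,-y,-t)$; Haar measure is Lebesgue measure $dx\,dy\,dt$ on $\mathbb{R}^3$. For $f,g\in L^1(\mathbb{H})$, the convolution is $(f*g)(x,y,t)=\int_{\mathbb{H}}f\big((x,y,t)(u,v,s)^{-1}\big)g(u,v,s)\,du\,dv\,ds$. The $B$-splines on $\mathbb{H}$ are $\phi_1=\frac{1}{\sqrt2}\chi_{[0,2]\times[0,1]\times[0,1]}$ and $\phi_{n+1}=\phi_n*\phi_1$ for $n\ge1$ (so $\phi_n$ is the $n$-fold convolution of $\phi_1$). Here $\operatorname{supp}$ denotes the closure of the set where the function is nonzero. *)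

theory Defs
  imports "HOL-Analysis.Analysis"
begin

type_synonym heis = "real \<times> real \<times> real"

fun heis_mult :: "heis \<Rightarrow> heis \<Rightarrow> heis" where
  "heis_mult (x, y, t) (x', y', t') = (x + x', y + y', t + t' + (x' * y - y' * x) / 2)"

fun heis_inv :: "heis \<Rightarrow> heis" where
  "heis_inv (x, y, t) = (- x, - y, - t)"

lemma heis_mult_inv: "heis_mult p (heis_inv p) = 0" "heis_mult (heis_inv p) p = 0"
  by (cases p; simp add: zero_prod_def)+

lemma heis_mult_assoc: "heis_mult (heis_mult p q) r = heis_mult p (heis_mult q r)"
  by (cases p; cases q; cases r; simp add: field_simps)

text \<open>The value is \<open>0\<close> at points where the integrand fails to be integrable.\<close>

definition heis_conv :: "(heis \<Rightarrow> real) \<Rightarrow> (heis \<Rightarrow> real) \<Rightarrow> heis \<Rightarrow> real" where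
  "heis_conv f g p = (\<integral>q. f (heis_mult p (heis_inv q)) * g q \<partial>lborel)"

definition heis_bspline1 :: "heis \<Rightarrow> real" where
  "heis_bspline1 p = 1 / sqrt 2 * indicator ({0..2} \<times> {0..1} \<times> {0..1}) p"

text \<open>The order starts at 1; no equation is given for order \<open>0\<close>.\<close>

fun heis_bspline :: "nat \<Rightarrow> heis \<Rightarrow> real" where
  "heis_bspline (Suc 0) = heis_bspline1"
| "heis_bspline (Suc (Suc n)) = heis_conv (heis_bspline (Suc n)) heis_bspline1"

definition supp :: "(heis \<Rightarrow> real) \<Rightarrow> heis set" where
  "supp f = closure {p. f p \<noteq> 0}"

end

theory Submission
  imports Defs
begin

text \<open>A convolution can be nonzero only on the product, in the group, of the sets where its
  factors are nonzero. So it suffices that the claimed box of order n times the box of order 1 lies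
  in the box of order n + 1 (\<open>heis_mult_bspline_box\<close>), and induction traps the nonzero
  set of each spline. The boxes are closed, so they also contain its closure.\<close>

text \<open>If the integrand vanished identically, so would the integral; at a \<open>q\<close>
  where it does not, take \<open>r\<close> to be \<open>p\<close> times the inverse of
  \<open>q\<close>.\<close>

lemma heis_conv_nonzeroE:
  assumes "heis_conv f g p \<noteq> 0"
  obtains r q where "f r \<noteq> 0" "g q \<noteq> 0" "p = heis_mult r q"
proof -
  have "\<exists>q. f (heis_mult p (heis_inv q)) * g q \<noteq> 0"
  proof (rule ccontr)
    assume "\<not> ?thesis"
    then have "(\<lambda>q. f (heis_mult p (heis_inv q)) * g q) = (\<lambda>q. 0)"
      by auto
    then show False
      using assms by (simp add: heis_conv_def)
  qed
  then obtain q where q: "f (heis_mult p (heis_inv q)) \<noteq> 0" "g q \<noteq> 0"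
    by auto
  have "heis_mult (heis_mult p (heis_inv q)) q = p"
    by (cases p; cases q; simp add: field_simps)
  with that q show thesis
    by metis
qed

text \<open>At n = 1 the last interval is [0, 1], so the formula also serves as the base case. A
  real parameter keeps the passage to n + 1 free of casts.\<close>

abbreviation (input) bspline_box :: "real \<Rightarrow> heis set" where
  "bspline_box n \<equiv> {0..2 * n} \<times> {0..n} \<times>
     {- (1/2) * (n + 2) * (n - 1) .. (1/2) * (n + 1) * (n + 2) - 2}"

text \<open>Only the last coordinate is delicate: both products in the twist lie in [0, 2n], so half
  their difference lies in [-n, n].\<close>

lemma heis_mult_bspline_box:
  assumes "r \<in> bspline_box n" "q \<in> bspline_box 1"
  shows "heis_mult r q \<in> bspline_box (n + 1)"
proof -
  obtain x y t where r: "r = (x, y, t)" by (cases r)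
  obtain u v s where q: "q = (u, v, s)" by (cases q)
  from assms have b: "0 \<le> x" "x \<le> 2 * n" "0 \<le> y" "y \<le> n" "0 \<le> u" "u \<le> 2" "0 \<le> v" "v \<le> 1"
      "0 \<le> s" "s \<le> 1"
      "- (1/2) * (n + 2) * (n - 1) \<le> t" "t \<le> (1/2) * (n + 1) * (n + 2) - 2"
    by (auto simp: r q)
  have "u * y \<le> 2 * n" "v * x \<le> 1 * (2 * n)"
    using b by (intro mult_mono; simp)+
  moreover have "0 \<le> u * y" "0 \<le> v * x"
    using b by simp_all
  ultimately have "- n \<le> (u * y - v * x) / 2" "(u * y - v * x) / 2 \<le> n"
    by simp_all
  \<comment> \<open>The ends move by n + 1 and n + 2, while the twist together with \<open>s\<close>
    in [0, 1] needs only n and n + 1.\<close>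
  moreover have "- (1/2) * (n + 1 + 2) * (n + 1 - 1) = - (1/2) * (n + 2) * (n - 1) - (n + 1)"
    "(1/2) * (n + 1 + 1) * (n + 1 + 2) - 2 = (1/2) * (n + 1) * (n + 2) - 2 + (n + 2)"
    by (simp_all add: field_simps)
  ultimately have "t + s + (u * y - v * x) / 2
      \<in> {- (1/2) * (n + 1 + 2) * (n + 1 - 1) .. (1/2) * (n + 1 + 1) * (n + 1 + 2) - 2}"
    using b unfolding atLeastAtMost_iff by (intro conjI; linarith)
  moreover have "x + u \<in> {0..2 * (n + 1)}" "y + v \<in> {0..n + 1}"
    using b by simp_all
  ultimately show ?thesis
    unfolding r q heis_mult.simps by (intro SigmaI)
qed

text \<open>Indexing by \<open>Suc n\<close> starts the induction at order 1, the first order with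
  an equation.\<close>

lemma heis_bspline_nonzero_subset:
  "{p. heis_bspline (Suc n) p \<noteq> 0} \<subseteq> bspline_box (real (Suc n))"
proof (induction n)
  case 0
  show ?case
    by (auto simp: heis_bspline1_def indicator_def split: if_splits)
next
  case (Suc n)
  show ?case
  proof
    fix p assume "p \<in> {p. heis_bspline (Suc (Suc n)) p \<noteq> 0}"
    then obtain r q where *: "heis_bspline (Suc n) r \<noteq> 0" "heis_bspline1 q \<noteq> 0" "p = heis_mult r q"
      by (auto elim: heis_conv_nonzeroE)
    have "q \<in> bspline_box 1"
      using *(2) by (auto simp: heis_bspline1_def indicator_def split: if_splits)
    with * Suc.IH have "p \<in> bspline_box (real (Suc n) + 1)"
      using heis_mult_bspline_box by blast
    then show "p \<in> bspline_box (real (Suc (Suc n)))"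
      by (simp add: algebra_simps)
  qed
qed

theorem theorem4p1:
  shows "supp (heis_bspline 1) = {0..2} \<times> {0..1} \<times> {0..1}
    \<and> (\<forall>n::nat. n \<ge> 2 \<longrightarrow>
        supp (heis_bspline n) \<subseteq>
          {0..2 * real n} \<times> {0..real n} \<times>
          {- (1/2) * (real n + 2) * (real n - 1) .. (1/2) * (real n + 1) * (real n + 2) - 2})"
proof (intro conjI allI impI)
  have "{p. heis_bspline 1 p \<noteq> 0} = {0..2} \<times> {0..1} \<times> {0..1}"
    by (auto simp: heis_bspline1_def indicator_def split: if_splits)
  then show "supp (heis_bspline 1) = {0..2} \<times> {0..1} \<times> {0..1}"
    unfolding supp_def by (simp add: closure_closed closed_Times)
next
  fix n :: nat assume "n \<ge> 2"
  then obtain m where "n = Suc m"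
    by (cases n) auto
  then show "supp (heis_bspline n) \<subseteq> bspline_box (real n)"
    \<comment> \<open>The closure is the least closed superset, and a product of closed intervals is
      closed.\<close>
    unfolding supp_def
    by (intro closure_minimal closed_Times closed_atLeastAtMost)
      (simp only: heis_bspline_nonzero_subset)
qed

end
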